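(* Let $\mathsf{M}$ be the product space of the matrix metric spaces $(\mathsf{M}_1,d_1)$ and $(\mathsf{M}_2,d_2)$, let $d$ be a metric on $\mathsf{M}$, and let $\mathcal{S}$ be the product approximation operator $\mathcal{S}(\mathbf{A})=\mathcal{S}_1(\mathbf{A}_1)\mathcal{S}_2(\mathbf{A}_2)$ built from approximation operators $\mathcal{S}_1$ on $\mathsf{M}_1$ and $\mathcal{S}_2$ on $\mathsf{M}_2$. Suppose $\mathcal{S}_1$ and $\mathcal{S}_2$ generate continuous (respectively, $\alpha$-Hölder continuous) matrix-valued functions with respect to $d_1$ and $d_2$, and assume that $d$ is majorized by some product metric $d_\psi$. Then $\mathcal{S}$ generates continuous (respectively, $\alpha$-Hölder continuous) matrix-valued functions with respect to $d$.
   Context: Product space: every $A\in\mathsf{M}$ has a unique decomposition $A=A_1A_2$ with $A_1\in\mathsf{M}_1$, $A_2\in\mathsf{M}_2$, and products generated below lie in $\mathsf{M}$. Operators: let $\mathtt{I}\subset\mathbb{R}$ be a compact interval. An approximation operator on a matrix class maps a data sequence $\{A^{(i)}\}_{i\in\mathcal{J}}$, $\mathcal{J}\subset\mathbb{Z}$, in the class to a function $\mathtt{I}\to$ (the class), the generated matrix-valued function. For a sequence $\mathbf{A}=\{A^{(i)}\}_{i\in\mathcal{J}}$ in $\mathsf{M}$ with $A^{(i)}=A_1^{(i)}A_2^{(i)}$, put $\mathbf{A}_j=\{A_j^{(i)}\}_{i\in\mathcal{J}}$; the product operator is the pointwise matrix product $\mathcal{S}(\mathbf{A})(t)=\mathcal{S}_1(\mathbf{A}_1)(t)\,\mathcal{S}_2(\mathbf{A}_2)(t)\in\mathsf{M}$.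 Product metric: $d_\psi(A,B)=\psi(d_1(A_1,B_1),d_2(A_2,B_2))$ for $A=A_1A_2$, $B=B_1B_2$, where $\psi\colon[0,\infty)^2\to[0,\infty)$ is continuous, vanishes exactly at $(0,0)$, is monotone in every variable, Jensen-convex ($\psi(\frac{x+y}{2})\le\frac12(\psi(x)+\psi(y))$ for $x,y\in[0,\infty)^2$) and homogeneous ($\psi(\alpha x_1,\alpha x_2)=\alpha\psi(x_1,x_2)$ for $\alpha\ge0$). Majorization: a metric $\bar d$ on a set $V$ is majorized by a metric $d'$ on $V$ if there is a constant $C>0$ with $\bar d(u,v)\le C\,d'(u,v)$ for all $u,v\in V$. Continuity of $\Gamma$ on $\mathtt{I}$ under a metric $d$: $\lim_{\triangle t\to0}d(\Gamma(t),\Gamma(t+\triangle t))=0$ for every $t\in \mathtt{I}$. A continuous $\Gamma$ is $\alpha$-Hölder continuous ($0<\alpha\le1$) if there is $C>0$ with $d(\Gamma(t),\Gamma(t+\triangle t))\le C|\triangle t|^\alpha$ whenever $t,t+\triangle t\in \mathtt{I}$. *)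

theory Defs
  imports "HOL-Analysis.Analysis"
begin

definition product_space ::
    "('a::field^'n^'m) set \<Rightarrow> ('a^'k^'m) set \<Rightarrow> ('a^'n^'k) set \<Rightarrow> bool" where
  "product_space M M1 M2 \<longleftrightarrow> (\<forall>A\<in>M. \<exists>!p. p \<in> M1 \<times> M2 \<and> A = fst p ** snd p)"

text \<open>The pair of factors is meaningful only for \<open>A\<close> with a unique decomposition.\<close>

definition factors ::
    "('a::field^'k^'m) set \<Rightarrow> ('a^'n^'k) set \<Rightarrow> 'a^'n^'m \<Rightarrow> ('a^'k^'m) \<times> ('a^'n^'k)" where
  "factors M1 M2 A = (THE p. p \<in> M1 \<times> M2 \<and> A = fst p ** snd p)"

definition factor1 ::
    "('a::field^'k^'m) set \<Rightarrow> ('a^'n^'k) set \<Rightarrow> 'a^'n^'m \<Rightarrow> 'a^'k^'m" where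
  "factor1 M1 M2 A = fst (factors M1 M2 A)"

definition factor2 ::
    "('a::field^'k^'m) set \<Rightarrow> ('a^'n^'k) set \<Rightarrow> 'a^'n^'m \<Rightarrow> 'a^'n^'k" where
  "factor2 M1 M2 A = snd (factors M1 M2 A)"

text \<open>Data sequences indexed by \<open>J\<close> in a class \<open>V\<close> are the elements of \<open>J \<rightarrow>\<^sub>E V\<close>;
  extensionality makes an operator depend only on the data at indices in \<open>J\<close>.\<close>

definition approximation_operator ::
    "real set \<Rightarrow> int set \<Rightarrow> 'v set \<Rightarrow> ((int \<Rightarrow> 'v) \<Rightarrow> real \<Rightarrow> 'v) \<Rightarrow> bool" where
  "approximation_operator I J V S \<longleftrightarrow> S \<in> (J \<rightarrow>\<^sub>E V) \<rightarrow> (I \<rightarrow> V)"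

definition product_operator ::
    "int set \<Rightarrow> ('a::field^'k^'m) set \<Rightarrow> ('a^'n^'k) set
      \<Rightarrow> ((int \<Rightarrow> 'a^'k^'m) \<Rightarrow> real \<Rightarrow> 'a^'k^'m)
      \<Rightarrow> ((int \<Rightarrow> 'a^'n^'k) \<Rightarrow> real \<Rightarrow> 'a^'n^'k)
      \<Rightarrow> (int \<Rightarrow> 'a^'n^'m) \<Rightarrow> real \<Rightarrow> 'a^'n^'m" where
  "product_operator J M1 M2 S1 S2 A t =
     S1 (\<lambda>i\<in>J. factor1 M1 M2 (A i)) t ** S2 (\<lambda>i\<in>J. factor2 M1 M2 (A i)) t"

text \<open>Only the values on the closed quadrant matter.\<close>

definition admissible_psi :: "(real \<times> real \<Rightarrow> real) \<Rightarrow> bool" where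
  "admissible_psi \<psi> \<longleftrightarrow>
     (let Q = {0..} \<times> {0..} in
       \<psi> \<in> Q \<rightarrow> {0..} \<and>
       continuous_on Q \<psi> \<and>
       (\<forall>x\<in>Q. \<psi> x = 0 \<longleftrightarrow> x = (0, 0)) \<and>
       (\<forall>y\<ge>0. mono_on {0..} (\<lambda>x. \<psi> (x, y))) \<and>
       (\<forall>x\<ge>0. mono_on {0..} (\<lambda>y. \<psi> (x, y))) \<and>
       (\<forall>x\<in>Q. \<forall>y\<in>Q. \<psi> ((1/2) *\<^sub>R (x + y)) \<le> 1/2 * (\<psi> x + \<psi> y)) \<and>
       (\<forall>\<alpha>\<ge>0. \<forall>x1\<ge>0. \<forall>x2\<ge>0. \<psi> (\<alpha> * x1, \<alpha> * x2) = \<alpha> * \<psi> (x1, x2)))"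

definition product_metric ::
    "('a::field^'k^'m) set \<Rightarrow> ('a^'n^'k) set
      \<Rightarrow> ('a^'k^'m \<Rightarrow> 'a^'k^'m \<Rightarrow> real) \<Rightarrow> ('a^'n^'k \<Rightarrow> 'a^'n^'k \<Rightarrow> real)
      \<Rightarrow> (real \<times> real \<Rightarrow> real) \<Rightarrow> 'a^'n^'m \<Rightarrow> 'a^'n^'m \<Rightarrow> real" where
  "product_metric M1 M2 d1 d2 \<psi> A B =
     \<psi> (d1 (factor1 M1 M2 A) (factor1 M1 M2 B), d2 (factor2 M1 M2 A) (factor2 M1 M2 B))"

definition majorized_by :: "'v set \<Rightarrow> ('v \<Rightarrow> 'v \<Rightarrow> real) \<Rightarrow> ('v \<Rightarrow> 'v \<Rightarrow> real) \<Rightarrow> bool" where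
  "majorized_by V d d' \<longleftrightarrow> (\<exists>C>0. \<forall>u\<in>V. \<forall>v\<in>V. d u v \<le> C * d' u v)"

text \<open>Increments are restricted to those keeping \<open>t + h\<close> in \<open>I\<close>, so at the end points
  of an interval the limit is one-sided.\<close>

definition continuous_under ::
    "real set \<Rightarrow> ('v \<Rightarrow> 'v \<Rightarrow> real) \<Rightarrow> (real \<Rightarrow> 'v) \<Rightarrow> bool" where
  "continuous_under I d \<Gamma> \<longleftrightarrow>
     (\<forall>t\<in>I. ((\<lambda>h. d (\<Gamma> t) (\<Gamma> (t + h))) \<longlongrightarrow> 0) (at 0 within {h. t + h \<in> I}))"

definition holder_under ::
    "real set \<Rightarrow> ('v \<Rightarrow> 'v \<Rightarrow> real) \<Rightarrow> real \<Rightarrow> (real \<Rightarrow> 'v) \<Rightarrow> bool" where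
  "holder_under I d \<alpha> \<Gamma> \<longleftrightarrow> continuous_under I d \<Gamma> \<and>
     (\<exists>C>0. \<forall>t h. t \<in> I \<longrightarrow> t + h \<in> I \<longrightarrow> d (\<Gamma> t) (\<Gamma> (t + h)) \<le> C * \<bar>h\<bar> powr \<alpha>)"

definition generates_continuous ::
    "real set \<Rightarrow> int set \<Rightarrow> 'v set \<Rightarrow> ('v \<Rightarrow> 'v \<Rightarrow> real) \<Rightarrow> ((int \<Rightarrow> 'v) \<Rightarrow> real \<Rightarrow> 'v) \<Rightarrow> bool" where
  "generates_continuous I J V d S \<longleftrightarrow> (\<forall>A \<in> J \<rightarrow>\<^sub>E V. continuous_under I d (S A))"

text \<open>The Hoelder constant may depend on the data sequence.\<close>

definition generates_holder ::
    "real set \<Rightarrow> int set \<Rightarrow> 'v set \<Rightarrow> ('v \<Rightarrow> 'v \<Rightarrow> real) \<Rightarrow> real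
      \<Rightarrow> ((int \<Rightarrow> 'v) \<Rightarrow> real \<Rightarrow> 'v) \<Rightarrow> bool" where
  "generates_holder I J V d \<alpha> S \<longleftrightarrow> (\<forall>A \<in> J \<rightarrow>\<^sub>E V. holder_under I d \<alpha> (S A))"

lemma factors_product_space:
  assumes "product_space M M1 M2" "A \<in> M"
  shows "factor1 M1 M2 A \<in> M1" "factor2 M1 M2 A \<in> M2"
    "factor1 M1 M2 A ** factor2 M1 M2 A = A"
proof -
  have "\<exists>!p. p \<in> M1 \<times> M2 \<and> A = fst p ** snd p"
    using assms unfolding product_space_def by blast
  from theI'[OF this]
  have *: "factors M1 M2 A \<in> M1 \<times> M2 \<and> A = fst (factors M1 M2 A) ** snd (factors M1 M2 A)"
    unfolding factors_def .
  then show "factor1 M1 M2 A \<in> M1" "factor2 M1 M2 A \<in> M2"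
    "factor1 M1 M2 A ** factor2 M1 M2 A = A"
    unfolding factor1_def factor2_def by (auto simp: mem_Times_iff)
qed

lemma product_metric_is_metric:
  assumes ps: "product_space M M1 M2" and m1: "Metric_space M1 d1" and m2: "Metric_space M2 d2"
    and psi: "admissible_psi \<psi>"
  shows "Metric_space M (product_metric M1 M2 d1 d2 \<psi>)"
proof -
  interpret X: Metric_space M1 d1 by fact
  interpret Y: Metric_space M2 d2 by fact
  have nn: "\<psi> (x, y) \<ge> 0" if "x \<ge> 0" "y \<ge> 0" for x y
    using psi that unfolding admissible_psi_def Let_def by auto
  have z: "\<psi> (x, y) = 0 \<longleftrightarrow> x = 0 \<and> y = 0" if "x \<ge> 0" "y \<ge> 0" for x y
    using psi that unfolding admissible_psi_def Let_def by auto
  have mono: "\<psi> (x, y) \<le> \<psi> (x', y')" if "0 \<le> x" "x \<le> x'" "0 \<le> y" "y \<le> y'" for x y x' y'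
  proof -
    have "\<psi> (x, y) \<le> \<psi> (x', y)"
      using psi that unfolding admissible_psi_def Let_def mono_on_def by auto
    also have "\<dots> \<le> \<psi> (x', y')"
      using psi that unfolding admissible_psi_def Let_def mono_on_def by auto
    finally show ?thesis .
  qed
  have sub: "\<psi> (x + x', y + y') \<le> \<psi> (x, y) + \<psi> (x', y')"
    if "0 \<le> x" "0 \<le> x'" "0 \<le> y" "0 \<le> y'" for x y x' y'
  proof -
    have J: "\<forall>x\<in>{0..} \<times> {0..}. \<forall>y\<in>{0..} \<times> {0..}. \<psi> ((1/2) *\<^sub>R (x + y)) \<le> 1/2 * (\<psi> x + \<psi> y)"
      and H: "\<forall>\<alpha>\<ge>0. \<forall>x1\<ge>0. \<forall>x2\<ge>0. \<psi> (\<alpha> * x1, \<alpha> * x2) = \<alpha> * \<psi> (x1, x2)"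
      using psi unfolding admissible_psi_def Let_def by blast+
    have "\<psi> ((1/2) *\<^sub>R ((x, y) + (x', y'))) \<le> 1/2 * (\<psi> (x, y) + \<psi> (x', y'))"
      using J that by blast
    moreover have "\<psi> ((1/2) * (x + x'), (1/2) * (y + y')) = (1/2) * \<psi> (x + x', y + y')"
      by (rule H[rule_format]) (use that in auto)
    ultimately show ?thesis by simp
  qed
  note fac = factors_product_space[OF ps]
  show ?thesis
  proof
    show "0 \<le> product_metric M1 M2 d1 d2 \<psi> A B" for A B
      unfolding product_metric_def by (rule nn) auto
    show "product_metric M1 M2 d1 d2 \<psi> A B = product_metric M1 M2 d1 d2 \<psi> B A" for A B
      unfolding product_metric_def by (simp add: X.commute Y.commute)
    show "product_metric M1 M2 d1 d2 \<psi> A B = 0 \<longleftrightarrow> A = B" if "A \<in> M" "B \<in> M" for A B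
    proof -
      have "product_metric M1 M2 d1 d2 \<psi> A B = 0 \<longleftrightarrow>
          factor1 M1 M2 A = factor1 M1 M2 B \<and> factor2 M1 M2 A = factor2 M1 M2 B"
        unfolding product_metric_def using fac(1,2)[OF that(1)] fac(1,2)[OF that(2)] by (simp add: z)
      also have "\<dots> \<longleftrightarrow> A = B"
        using fac(3)[OF that(1)] fac(3)[OF that(2)] by metis
      finally show ?thesis .
    qed
    show "product_metric M1 M2 d1 d2 \<psi> A C
        \<le> product_metric M1 M2 d1 d2 \<psi> A B + product_metric M1 M2 d1 d2 \<psi> B C"
      if "A \<in> M" "B \<in> M" "C \<in> M" for A B C
      unfolding product_metric_def
    proof (rule order_trans[OF mono sub])
      show "d1 (factor1 M1 M2 A) (factor1 M1 M2 C)
          \<le> d1 (factor1 M1 M2 A) (factor1 M1 M2 B) + d1 (factor1 M1 M2 B) (factor1 M1 M2 C)"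
        by (intro X.triangle fac(1) that)
      show "d2 (factor2 M1 M2 A) (factor2 M1 M2 C)
          \<le> d2 (factor2 M1 M2 A) (factor2 M1 M2 B) + d2 (factor2 M1 M2 B) (factor2 M1 M2 C)"
        by (intro Y.triangle fac(2) that)
    qed simp_all
  qed
qed

end

theory Submission
  imports Defs
begin

text \<open>
  The product operator is built from values of the two factor operators, and since
  decompositions in the product space are unique, those values \<^emph>\<open>are\<close> the factors of the
  generated matrix. Hence the product metric between two values of the generated function is
  \<open>\<psi>\<close> evaluated at the two factor distances (\<open>factor_mult\<close>).

  Monotonicity and homogeneity bound \<open>\<psi> (x, y)\<close> by \<open>\<psi> (1, 1) * max x y\<close>
  (\<open>admissible_psi_le\<close>). With the majorization, a distance between two values of the
  generated function is therefore at most a constant times the sum of the corresponding distances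
  for the two factor functions (\<open>product_operator_dist_le\<close>). Such a linear bound carries
  over both the limit \<open>0\<close> and the estimate by \<open>\<bar>h\<bar> powr \<alpha>\<close>.
\<close>

lemma factor_mult:
  assumes "product_space M M1 M2" "A \<in> M1" "B \<in> M2" "A ** B \<in> M"
  shows "factor1 M1 M2 (A ** B) = A" "factor2 M1 M2 (A ** B) = B"
proof -
  have "\<exists>!p. p \<in> M1 \<times> M2 \<and> A ** B = fst p ** snd p"
    using assms(1,4) unfolding product_space_def by blast
  then have "factors M1 M2 (A ** B) = (A, B)"
    unfolding factors_def by (rule the1_equality) (use assms(2,3) in simp)
  then show "factor1 M1 M2 (A ** B) = A" "factor2 M1 M2 (A ** B) = B"
    unfolding factor1_def factor2_def by simp_all
qed

lemma admissible_psi_pos: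
  assumes "admissible_psi \<psi>"
  shows "\<psi> (1, 1) > 0"
proof -
  have "\<psi> (1, 1) \<ge> 0" "\<psi> (1, 1) \<noteq> 0"
    using assms unfolding admissible_psi_def Let_def by auto
  then show ?thesis by simp
qed

text \<open>Raising both arguments to their maximum reaches the diagonal, where homogeneity
  determines \<open>\<psi>\<close>.\<close>

lemma admissible_psi_le:
  assumes psi: "admissible_psi \<psi>" and "x \<ge> 0" "y \<ge> 0"
  shows "\<psi> (x, y) \<le> \<psi> (1, 1) * max x y"
proof -
  have m1: "\<forall>y\<ge>0. mono_on {0..} (\<lambda>x. \<psi> (x, y))"
    and m2: "\<forall>x\<ge>0. mono_on {0..} (\<lambda>y. \<psi> (x, y))"
    and hom: "\<forall>\<alpha>\<ge>0. \<forall>x1\<ge>0. \<forall>x2\<ge>0. \<psi> (\<alpha> * x1, \<alpha> * x2) = \<alpha> * \<psi> (x1, x2)"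
    using psi unfolding admissible_psi_def Let_def by blast+
  define m where "m = max x y"
  have m: "x \<le> m" "y \<le> m" "m \<ge> 0"
    using assms(2) by (auto simp: m_def)
  have "\<psi> (x, y) \<le> \<psi> (m, y)"
    using m1 assms(2,3) m by (auto simp: mono_on_def)
  also have "\<dots> \<le> \<psi> (m, m)"
    using m2 assms(2,3) m by (auto simp: mono_on_def)
  also have "\<dots> = m * \<psi> (1, 1)"
    using hom[rule_format, of m 1 1] m by simp
  finally show ?thesis
    by (simp add: m_def mult.commute)
qed

text \<open>The constant depends neither on the data nor on the points of evaluation.\<close>

lemma product_operator_dist_le:
  assumes ps: "product_space M M1 M2"
    and met: "Metric_space M1 d1" "Metric_space M2 d2"
    and S1: "approximation_operator I J M1 S1" and S2: "approximation_operator I J M2 S2"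
    and S: "approximation_operator I J M (product_operator J M1 M2 S1 S2)"
    and psi: "admissible_psi \<psi>" and maj: "majorized_by M d (product_metric M1 M2 d1 d2 \<psi>)"
  obtains K where "K > 0"
    and "\<And>A s t. A \<in> J \<rightarrow>\<^sub>E M \<Longrightarrow> s \<in> I \<Longrightarrow> t \<in> I \<Longrightarrow>
      d (product_operator J M1 M2 S1 S2 A s) (product_operator J M1 M2 S1 S2 A t) \<le>
      K * (d1 (S1 (\<lambda>i\<in>J. factor1 M1 M2 (A i)) s) (S1 (\<lambda>i\<in>J. factor1 M1 M2 (A i)) t) +
           d2 (S2 (\<lambda>i\<in>J. factor2 M1 M2 (A i)) s) (S2 (\<lambda>i\<in>J. factor2 M1 M2 (A i)) t))"
proof -
  obtain C where "C > 0" and C: "\<And>u v. u \<in> M \<Longrightarrow> v \<in> M \<Longrightarrow>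
      d u v \<le> C * product_metric M1 M2 d1 d2 \<psi> u v"
    using maj unfolding majorized_by_def by blast
  show thesis
  proof
    show "C * \<psi> (1, 1) > 0"
      using \<open>C > 0\<close> admissible_psi_pos[OF psi] by simp
    fix A s t
    assume A: "A \<in> J \<rightarrow>\<^sub>E M" and st: "s \<in> I" "t \<in> I"
    let ?P = "product_operator J M1 M2 S1 S2 A"
    define G1 where "G1 = S1 (\<lambda>i\<in>J. factor1 M1 M2 (A i))"
    define G2 where "G2 = S2 (\<lambda>i\<in>J. factor2 M1 M2 (A i))"
    have "(\<lambda>i\<in>J. factor1 M1 M2 (A i)) \<in> J \<rightarrow>\<^sub>E M1" "(\<lambda>i\<in>J. factor2 M1 M2 (A i)) \<in> J \<rightarrow>\<^sub>E M2"
      using A factors_product_space(1,2)[OF ps] by auto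
    then have G: "G1 r \<in> M1" "G2 r \<in> M2" if "r \<in> I" for r
      using S1 S2 that unfolding approximation_operator_def G1_def G2_def by (auto simp: Pi_iff)
    have P: "?P r = G1 r ** G2 r" for r
      by (simp add: product_operator_def G1_def G2_def)
    have PM: "?P r \<in> M" if "r \<in> I" for r
      using S A that unfolding approximation_operator_def by (auto simp: Pi_iff)
    have fac: "factor1 M1 M2 (?P r) = G1 r" "factor2 M1 M2 (?P r) = G2 r" if "r \<in> I" for r
      using factor_mult[OF ps G[OF that]] PM[OF that] unfolding P by blast+
    have nn: "d1 (G1 s) (G1 t) \<ge> 0" "d2 (G2 s) (G2 t) \<ge> 0"
      using met by (simp_all add: Metric_space.nonneg)
    have "d (?P s) (?P t) \<le> C * \<psi> (d1 (G1 s) (G1 t), d2 (G2 s) (G2 t))"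
      using C[OF PM[OF st(1)] PM[OF st(2)]] by (simp add: product_metric_def fac st)
    also have "\<dots> \<le> C * (\<psi> (1, 1) * max (d1 (G1 s) (G1 t)) (d2 (G2 s) (G2 t)))"
      using admissible_psi_le[OF psi nn] \<open>C > 0\<close> by (intro mult_left_mono) auto
    also have "\<dots> \<le> C * (\<psi> (1, 1) * (d1 (G1 s) (G1 t) + d2 (G2 s) (G2 t)))"
      using nn \<open>C > 0\<close> admissible_psi_pos[OF psi] by (intro mult_left_mono) auto
    finally show "d (?P s) (?P t) \<le> C * \<psi> (1, 1) *
        (d1 (S1 (\<lambda>i\<in>J. factor1 M1 M2 (A i)) s) (S1 (\<lambda>i\<in>J. factor1 M1 M2 (A i)) t) +
         d2 (S2 (\<lambda>i\<in>J. factor2 M1 M2 (A i)) s) (S2 (\<lambda>i\<in>J. factor2 M1 M2 (A i)) t))"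
      by (simp add: G1_def G2_def mult.assoc)
  qed
qed

lemma continuous_under_le_add:
  assumes "continuous_under I d1 \<Gamma>1" "continuous_under I d2 \<Gamma>2"
    and nonneg: "\<And>u v. d u v \<ge> 0"
    and bound: "\<And>s t. s \<in> I \<Longrightarrow> t \<in> I \<Longrightarrow>
      d (\<Gamma> s) (\<Gamma> t) \<le> K * (d1 (\<Gamma>1 s) (\<Gamma>1 t) + d2 (\<Gamma>2 s) (\<Gamma>2 t))"
  shows "continuous_under I d \<Gamma>"
  unfolding continuous_under_def
proof
  fix t assume t: "t \<in> I"
  let ?F = "at 0 within {h. t + h \<in> I}"
  have "((\<lambda>h. d1 (\<Gamma>1 t) (\<Gamma>1 (t + h))) \<longlongrightarrow> 0) ?F" "((\<lambda>h. d2 (\<Gamma>2 t) (\<Gamma>2 (t + h))) \<longlongrightarrow> 0) ?F"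
    using assms(1,2) t unfolding continuous_under_def by blast+
  then have lim: "((\<lambda>h. K * (d1 (\<Gamma>1 t) (\<Gamma>1 (t + h)) + d2 (\<Gamma>2 t) (\<Gamma>2 (t + h)))) \<longlongrightarrow> 0) ?F"
    by (intro tendsto_mult_right_zero tendsto_add_zero)
  show "((\<lambda>h. d (\<Gamma> t) (\<Gamma> (t + h))) \<longlongrightarrow> 0) ?F"
  proof (rule tendsto_sandwich[OF _ _ tendsto_const lim])
    show "\<forall>\<^sub>F h in ?F. 0 \<le> d (\<Gamma> t) (\<Gamma> (t + h))"
      by (simp add: nonneg)
    show "\<forall>\<^sub>F h in ?F. d (\<Gamma> t) (\<Gamma> (t + h)) \<le>
        K * (d1 (\<Gamma>1 t) (\<Gamma>1 (t + h)) + d2 (\<Gamma>2 t) (\<Gamma>2 (t + h)))"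
      by (auto simp: eventually_at_filter bound t)
  qed
qed

lemma holder_under_le_add:
  assumes h1: "holder_under I d1 \<alpha> \<Gamma>1" and h2: "holder_under I d2 \<alpha> \<Gamma>2"
    and nonneg: "\<And>u v. d u v \<ge> 0" and "K > 0"
    and bound: "\<And>s t. s \<in> I \<Longrightarrow> t \<in> I \<Longrightarrow>
      d (\<Gamma> s) (\<Gamma> t) \<le> K * (d1 (\<Gamma>1 s) (\<Gamma>1 t) + d2 (\<Gamma>2 s) (\<Gamma>2 t))"
  shows "holder_under I d \<alpha> \<Gamma>"
proof -
  have "continuous_under I d \<Gamma>"
    using nonneg bound h1 h2 unfolding holder_under_def by (blast intro: continuous_under_le_add)
  moreover obtain C1 where "C1 > 0" and C1: "\<And>t h. t \<in> I \<Longrightarrow> t + h \<in> I \<Longrightarrow>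
      d1 (\<Gamma>1 t) (\<Gamma>1 (t + h)) \<le> C1 * \<bar>h\<bar> powr \<alpha>"
    using h1 unfolding holder_under_def by blast
  moreover obtain C2 where "C2 > 0" and C2: "\<And>t h. t \<in> I \<Longrightarrow> t + h \<in> I \<Longrightarrow>
      d2 (\<Gamma>2 t) (\<Gamma>2 (t + h)) \<le> C2 * \<bar>h\<bar> powr \<alpha>"
    using h2 unfolding holder_under_def by blast
  moreover have "d (\<Gamma> t) (\<Gamma> (t + h)) \<le> K * (C1 + C2) * \<bar>h\<bar> powr \<alpha>"
    if th: "t \<in> I" "t + h \<in> I" for t h
  proof -
    have "d (\<Gamma> t) (\<Gamma> (t + h)) \<le> K * (d1 (\<Gamma>1 t) (\<Gamma>1 (t + h)) + d2 (\<Gamma>2 t) (\<Gamma>2 (t + h)))"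
      using th by (rule bound)
    also have "\<dots> \<le> K * (C1 * \<bar>h\<bar> powr \<alpha> + C2 * \<bar>h\<bar> powr \<alpha>)"
      using C1[OF th] C2[OF th] \<open>K > 0\<close> by (intro mult_left_mono add_mono) auto
    finally show ?thesis
      by (simp add: algebra_simps)
  qed
  ultimately show ?thesis
    using \<open>K > 0\<close> unfolding holder_under_def by (metis add_pos_pos mult_pos_pos)
qed

theorem corollary5p4:
  fixes M :: "('a::field^'n^'m) set"
    and M1 :: "('a^'k^'m) set"
    and M2 :: "('a^'n^'k) set"
    and d :: "'a^'n^'m \<Rightarrow> 'a^'n^'m \<Rightarrow> real"
    and d1 :: "'a^'k^'m \<Rightarrow> 'a^'k^'m \<Rightarrow> real"
    and d2 :: "'a^'n^'k \<Rightarrow> 'a^'n^'k \<Rightarrow> real"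
    and S1 :: "(int \<Rightarrow> 'a^'k^'m) \<Rightarrow> real \<Rightarrow> 'a^'k^'m"
    and S2 :: "(int \<Rightarrow> 'a^'n^'k) \<Rightarrow> real \<Rightarrow> 'a^'n^'k"
    and J :: "int set" and a b :: real
  assumes "a \<le> b"
    and "Metric_space M1 d1" and "Metric_space M2 d2" and "Metric_space M d"
    and "product_space M M1 M2"
    and "approximation_operator {a..b} J M1 S1"
    and "approximation_operator {a..b} J M2 S2"
    and "approximation_operator {a..b} J M (product_operator J M1 M2 S1 S2)"
    and "\<exists>\<psi>. admissible_psi \<psi> \<and> majorized_by M d (product_metric M1 M2 d1 d2 \<psi>)"
  shows "(generates_continuous {a..b} J M1 d1 S1 \<and> generates_continuous {a..b} J M2 d2 S2 \<longrightarrow>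
            generates_continuous {a..b} J M d (product_operator J M1 M2 S1 S2)) \<and>
         (\<forall>\<alpha>. 0 < \<alpha> \<and> \<alpha> \<le> 1 \<longrightarrow>
            generates_holder {a..b} J M1 d1 \<alpha> S1 \<and> generates_holder {a..b} J M2 d2 \<alpha> S2 \<longrightarrow>
            generates_holder {a..b} J M d \<alpha> (product_operator J M1 M2 S1 S2))"
proof -
  let ?S = "product_operator J M1 M2 S1 S2"
  let ?A1 = "\<lambda>A. \<lambda>i\<in>J. factor1 M1 M2 (A i)"
  let ?A2 = "\<lambda>A. \<lambda>i\<in>J. factor2 M1 M2 (A i)"
  obtain \<psi> where "admissible_psi \<psi>" "majorized_by M d (product_metric M1 M2 d1 d2 \<psi>)"
    using assms(9) by blast
  then obtain K where "K > 0" and K: "\<And>A s t. A \<in> J \<rightarrow>\<^sub>E M \<Longrightarrow> s \<in> {a..b} \<Longrightarrow> t \<in> {a..b} \<Longrightarrow>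
      d (?S A s) (?S A t) \<le> K * (d1 (S1 (?A1 A) s) (S1 (?A1 A) t) + d2 (S2 (?A2 A) s) (S2 (?A2 A) t))"
    using product_operator_dist_le[OF assms(5,2,3,6-8)] by metis
  have nonneg: "d u v \<ge> 0" for u v
    using assms(4) by (rule Metric_space.nonneg)
  have mem: "?A1 A \<in> J \<rightarrow>\<^sub>E M1" "?A2 A \<in> J \<rightarrow>\<^sub>E M2" if "A \<in> J \<rightarrow>\<^sub>E M" for A
    using that factors_product_space(1,2)[OF assms(5)] by auto
  show ?thesis
  proof (intro conjI allI impI)
    assume gen: "generates_continuous {a..b} J M1 d1 S1 \<and> generates_continuous {a..b} J M2 d2 S2"
    show "generates_continuous {a..b} J M d ?S"
      unfolding generates_continuous_def
    proof
      fix A assume A: "A \<in> J \<rightarrow>\<^sub>E M"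
      have "continuous_under {a..b} d1 (S1 (?A1 A))" "continuous_under {a..b} d2 (S2 (?A2 A))"
        using gen mem[OF A] unfolding generates_continuous_def by blast+
      then show "continuous_under {a..b} d (?S A)"
        by (rule continuous_under_le_add) (fact nonneg, fact K[OF A])
    qed
  next
    fix \<alpha> :: real
    assume gen: "generates_holder {a..b} J M1 d1 \<alpha> S1 \<and> generates_holder {a..b} J M2 d2 \<alpha> S2"
    show "generates_holder {a..b} J M d \<alpha> ?S"
      unfolding generates_holder_def
    proof
      fix A assume A: "A \<in> J \<rightarrow>\<^sub>E M"
      have "holder_under {a..b} d1 \<alpha> (S1 (?A1 A))" "holder_under {a..b} d2 \<alpha> (S2 (?A2 A))"
        using gen mem[OF A] unfolding generates_holder_def by blast+
      then show "holder_under {a..b} d \<alpha> (?S A)"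
        by (rule holder_under_le_add) (fact nonneg, fact \<open>K > 0\<close>, fact K[OF A])
    qed
  qed
qed

end
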